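(* Let $\mathcal{F}$ be a field in which $2$ is invertible, and let $H_n(\mathcal{F})$ be the Jordan algebra of $n\times n$ symmetric matrices over $\mathcal{F}$, $n>1$. Then any additive local inner derivation on $H_n(\mathcal{F})$ is a derivation.
   Context: $H_n(\mathcal{F})=\{a\in M_n(\mathcal{F}): a^{i,j}=a^{j,i} \text{ for all } i,j\}$ is a Jordan algebra under addition and the Jordan product $a\cdot b=\frac12(ab+ba)$. A derivation of a Jordan algebra $\mathcal{A}$ is a linear map $D:\mathcal{A}\to\mathcal{A}$ with $D(x\cdot y)=D(x)\cdot y+x\cdot D(y)$ for all $x,y$. For $x\in\mathcal{A}$ let $L_x:\mathcal{A}\to\mathcal{A}$, $L_x(y)=x\cdot y$. An inner derivation of $\mathcal{A}$ is a finite sum $\sum_{k=1}^m [L_{a_k},L_{b_k}]$ with $a_k,b_k\in\mathcal{A}$, where $[S,T]=ST-TS$. An additive (not necessarily homogeneous) map $\nabla:\mathcal{A}\to\mathcal{A}$ is called an additive local inner derivation if for every $x\in\mathcal{A}$ there exists an inner derivation $D$ of $\mathcal{A}$ (depending on $x$) such that $\nabla(x)=D(x)$. *)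

theory Defs
  imports "HOL-Analysis.Analysis"
begin

text \<open>
  An algebra is given by a carrier set \<open>A\<close> inside an abelian group type, a scalar multiplication
  \<open>sc\<close> and a product \<open>jp\<close>. Maps \<open>A \<rightarrow> A\<close> are HOL functions that send \<open>A\<close> to \<open>A\<close>; their
  values outside \<open>A\<close> are irrelevant to all the notions below.
\<close>

definition additive_map_on :: "'v::ab_group_add set \<Rightarrow> ('v \<Rightarrow> 'v) \<Rightarrow> bool" where
  "additive_map_on A f \<longleftrightarrow>
     (\<forall>x\<in>A. f x \<in> A) \<and> (\<forall>x\<in>A. \<forall>y\<in>A. f (x + y) = f x + f y)"

definition linear_map_on :: "'v::ab_group_add set \<Rightarrow> ('k \<Rightarrow> 'v \<Rightarrow> 'v) \<Rightarrow> ('v \<Rightarrow> 'v) \<Rightarrow> bool" where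
  "linear_map_on A sc f \<longleftrightarrow>
     additive_map_on A f \<and> (\<forall>c. \<forall>x\<in>A. f (sc c x) = sc c (f x))"

definition derivation_on ::
    "'v::ab_group_add set \<Rightarrow> ('k \<Rightarrow> 'v \<Rightarrow> 'v) \<Rightarrow> ('v \<Rightarrow> 'v \<Rightarrow> 'v) \<Rightarrow> ('v \<Rightarrow> 'v) \<Rightarrow> bool" where
  "derivation_on A sc jp D \<longleftrightarrow>
     linear_map_on A sc D \<and> (\<forall>x\<in>A. \<forall>y\<in>A. D (jp x y) = jp (D x) y + jp x (D y))"

definition left_mult :: "('v \<Rightarrow> 'v \<Rightarrow> 'v) \<Rightarrow> 'v \<Rightarrow> 'v \<Rightarrow> 'v" where
  "left_mult jp a = (\<lambda>x. jp a x)"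

definition map_commutator :: "('v \<Rightarrow> 'v) \<Rightarrow> ('v \<Rightarrow> 'v) \<Rightarrow> 'v \<Rightarrow> 'v::ab_group_add" where
  "map_commutator S T = (\<lambda>x. S (T x) - T (S x))"

definition inner_derivation_on ::
    "'v::ab_group_add set \<Rightarrow> ('v \<Rightarrow> 'v \<Rightarrow> 'v) \<Rightarrow> ('v \<Rightarrow> 'v) \<Rightarrow> bool" where
  "inner_derivation_on A jp D \<longleftrightarrow>
     (\<exists>(m::nat) a b. (\<forall>k<m. a k \<in> A \<and> b k \<in> A) \<and>
        (\<forall>x\<in>A. D x = (\<Sum>k<m. map_commutator (left_mult jp (a k)) (left_mult jp (b k)) x)))"

definition additive_local_inner_derivation_on ::
    "'v::ab_group_add set \<Rightarrow> ('v \<Rightarrow> 'v \<Rightarrow> 'v) \<Rightarrow> ('v \<Rightarrow> 'v) \<Rightarrow> bool" where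
  "additive_local_inner_derivation_on A jp f \<longleftrightarrow>
     additive_map_on A f \<and> (\<forall>x\<in>A. \<exists>D. inner_derivation_on A jp D \<and> f x = D x)"

definition sym_matrices :: "('a::field ^ 'n ^ 'n) set" where
  "sym_matrices = {a. \<forall>i j. a $ i $ j = a $ j $ i}"

text \<open>
  The library operation \<open>(*s)\<close> on \<^typ>\<open>'a ^ 'n ^ 'n\<close> takes its scalar from the type of rows,
  so it is not the scalar multiplication of matrices.
\<close>

definition matrix_scale :: "'a::field \<Rightarrow> 'a ^ 'n ^ 'n \<Rightarrow> 'a ^ 'n ^ 'n" where
  "matrix_scale c x = (\<chi> i j. c * x $ i $ j)"

definition jordan_prod :: "'a::field ^ 'n ^ 'n \<Rightarrow> 'a ^ 'n ^ 'n \<Rightarrow> 'a ^ 'n ^ 'n" where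
  "jordan_prod a b = matrix_scale (1 / 2) (a ** b + b ** a)"

lemma jordan_prod_in_sym_matrices:
  assumes "a \<in> sym_matrices" "b \<in> sym_matrices"
  shows "jordan_prod a b \<in> sym_matrices"
proof -
  have "(a ** b) $ i $ j = (b ** a) $ j $ i" for i j
    using assms by (simp add: sym_matrices_def matrix_matrix_mult_def mult.commute)
  then show ?thesis
    by (simp add: sym_matrices_def jordan_prod_def matrix_scale_def add.commute)
qed

end

theory Submission
  imports Defs
begin

text \<open>
  The commutator \<open>[L\<^bsub>a\<^esub>, L\<^bsub>b\<^esub>]\<close> of Jordan multiplications is \<open>x \<mapsto> [[a, b]/4, x]\<close>, and \<open>[a, b]\<close> is
  skew-symmetric when \<open>a\<close> and \<open>b\<close> are symmetric. So an additive local inner derivation is an additive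
  map \<open>f\<close> such that every value \<open>f x\<close> is \<open>[s, x]\<close> for some skew-symmetric \<open>s\<close> that may depend on
  \<open>x\<close> (\<open>inner_derivation_is_skew_commutator\<close>). The point is to find one \<open>S\<close> that serves all \<open>x\<close>.

  Write \<open>F\<^bsub>ij\<^esub>(c) = c (e\<^bsub>ij\<^esub> + e\<^bsub>ji\<^esub>)\<close>. Since \<open>2 \<noteq> 0\<close>, these matrices generate the symmetric
  matrices additively. The diagonal entries of \<open>[s, F\<^bsub>ij\<^esub>(1)]\<close> at \<open>i\<close> and \<open>j\<close> are \<open>2 s\<^bsub>ij\<^esub>\<close> and
  \<open>2 s\<^bsub>ji\<^esub>\<close>, so a candidate \<open>S\<close> can be read off from the values \<open>f (F\<^bsub>ij\<^esub>(1))\<close>, and it is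
  skew-symmetric.

  Additivity alone gives no compatibility with scalars. It comes from testing \<open>f\<close> on
  \<open>F\<^bsub>ii\<^esub>(a) + F\<^bsub>ij\<^esub>(c)\<close>: one and the same \<open>s\<close> governs the entry that sees only \<open>a\<close> and the entry
  that sees only \<open>c\<close>, so additive functions \<open>\<alpha>\<close> and \<open>\<beta>\<close> occur with \<open>\<alpha>(a) = -2 a t\<close> and
  \<open>\<beta>(c) = 2 c t\<close>, where \<open>t\<close> may depend on \<open>a\<close> and \<open>c\<close>; setting one of the arguments to \<open>1\<close> shows
  that \<open>t\<close> is constant (\<open>local_values_on_block\<close>).

  Hence \<open>g x = f x - [S, x]\<close> vanishes on diagonal matrices, and for \<open>i \<noteq> j\<close> the matrix
  \<open>g (F\<^bsub>ij\<^esub>(c))\<close> can be nonzero only at positions \<open>(k, i)\<close>, \<open>(k, j)\<close> and their transposes, with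
  \<open>k \<noteq> i, j\<close>. Adding to \<open>F\<^bsub>ij\<^esub>(c)\<close> the matrix \<open>c (e\<^bsub>ii\<^esub> + e\<^bsub>jj\<^esub>)\<close> or its negative does not change
  the value of \<open>g\<close>, but makes the \<open>(i, j)\<close> block singular: the first choice forces the two entries to
  be equal and the second forces them to be opposite, so both are zero. Therefore \<open>g = 0\<close> and
  \<open>f = [S, -]\<close>, which is a derivation.
\<close>

section \<open>Commutators of matrices\<close>

definition commutator :: "'a::field ^ 'n ^ 'n \<Rightarrow> 'a ^ 'n ^ 'n \<Rightarrow> 'a ^ 'n ^ 'n" where
  "commutator s x = s ** x - x ** s"

definition skew_matrices :: "('a::field ^ 'n ^ 'n) set" where
  "skew_matrices = {s. \<forall>i j. s $ i $ j = - s $ j $ i}"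

lemma matrix_add_rdistrib':
  fixes a b c :: "'a::field ^ 'n ^ 'n"
  shows "(a + b) ** c = a ** c + b ** c"
  by (simp add: vec_eq_iff matrix_matrix_mult_def distrib_right sum.distrib)

lemma matrix_diff_ldistrib:
  fixes a b c :: "'a::field ^ 'n ^ 'n"
  shows "a ** (b - c) = a ** b - a ** c"
  by (simp add: vec_eq_iff matrix_matrix_mult_def right_diff_distrib sum_subtractf)

lemma matrix_diff_rdistrib:
  fixes a b c :: "'a::field ^ 'n ^ 'n"
  shows "(a - b) ** c = a ** c - b ** c"
  by (simp add: vec_eq_iff matrix_matrix_mult_def left_diff_distrib sum_subtractf)

lemma matrix_scale_mult:
  fixes a b :: "'a::field ^ 'n ^ 'n"
  shows "matrix_scale c a ** b = matrix_scale c (a ** b)"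
    and "a ** matrix_scale c b = matrix_scale c (a ** b)"
  by (simp_all add: vec_eq_iff matrix_matrix_mult_def matrix_scale_def sum_distrib_left ac_simps)

lemma matrix_scale_add: "matrix_scale c (a + b) = matrix_scale c a + matrix_scale c b"
  by (simp add: vec_eq_iff matrix_scale_def distrib_left)

lemma matrix_scale_diff: "matrix_scale c (a - b) = matrix_scale c a - matrix_scale c b"
  by (simp add: vec_eq_iff matrix_scale_def right_diff_distrib)

lemmas matrix_distribs = matrix_add_ldistrib matrix_add_rdistrib' matrix_diff_ldistrib
  matrix_diff_rdistrib matrix_scale_mult matrix_scale_add matrix_scale_diff

lemma commutator_add_right: "commutator s (x + y) = commutator s x + commutator s y"
  by (simp add: commutator_def matrix_distribs)

lemma commutator_add_left: "commutator (s + t) x = commutator s x + commutator t x"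
  by (simp add: commutator_def matrix_distribs)

lemma commutator_diff_left: "commutator (s - t) x = commutator s x - commutator t x"
  by (simp add: commutator_def matrix_distribs)

lemma commutator_matrix_scale: "commutator s (matrix_scale c x) = matrix_scale c (commutator s x)"
  by (simp add: commutator_def matrix_distribs)

lemma commutator_jordan_prod:
  "commutator s (jordan_prod x y) =
     jordan_prod (commutator s x) y + jordan_prod x (commutator s y)"
  unfolding commutator_def jordan_prod_def matrix_distribs matrix_mul_assoc
  by (simp only: algebra_simps)

lemma sym_matrices_add: "x \<in> sym_matrices \<Longrightarrow> y \<in> sym_matrices \<Longrightarrow> x + y \<in> sym_matrices"
  by (simp add: sym_matrices_def)

lemma skew_matrices_add: "s \<in> skew_matrices \<Longrightarrow> t \<in> skew_matrices \<Longrightarrow> s + t \<in> skew_matrices"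
  unfolding skew_matrices_def mem_Collect_eq vector_add_component
  by (metis minus_add_distrib)

lemma skew_matrices_diff: "s \<in> skew_matrices \<Longrightarrow> t \<in> skew_matrices \<Longrightarrow> s - t \<in> skew_matrices"
  unfolding skew_matrices_def mem_Collect_eq vector_minus_component
  by (metis minus_diff_minus)

lemma skew_matrices_scale: "s \<in> skew_matrices \<Longrightarrow> matrix_scale c s \<in> skew_matrices"
  unfolding skew_matrices_def matrix_scale_def mem_Collect_eq vec_lambda_beta
  by (metis mult_minus_right)

lemma commutator_skew_sym:
  assumes "s \<in> skew_matrices" "x \<in> sym_matrices"
  shows "commutator s x \<in> sym_matrices"
proof -
  have "(s ** x) $ i $ j = - (x ** s) $ j $ i" for i j
  proof -
    have "s $ i $ k * x $ k $ j = - (x $ j $ k * s $ k $ i)" for k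
      using assms unfolding skew_matrices_def sym_matrices_def mem_Collect_eq
      by (metis mult.commute mult_minus_right)
    then show ?thesis
      by (simp add: matrix_matrix_mult_def sum_negf)
  qed
  then show ?thesis
    by (simp add: sym_matrices_def commutator_def)
qed

lemma commutator_sym_sym_skew:
  assumes "a \<in> sym_matrices" "b \<in> sym_matrices"
  shows "commutator a b \<in> skew_matrices"
proof -
  have "(a ** b) $ i $ j = (b ** a) $ j $ i" for i j
    using assms by (simp add: sym_matrices_def matrix_matrix_mult_def mult.commute)
  then show ?thesis
    by (simp add: skew_matrices_def commutator_def)
qed

section \<open>Inner derivations of the Jordan algebra of symmetric matrices\<close>

lemma map_commutator_jordan_prod:
  fixes a b x :: "'a::field ^ 'n ^ 'n"
  shows "map_commutator (left_mult jordan_prod a) (left_mult jordan_prod b) x =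
    commutator (matrix_scale (1/4) (commutator a b)) x"
proof -
  have quarter: "matrix_scale (1/2) (matrix_scale (1/2) y) = matrix_scale (1/4) y"
    for y :: "'a ^ 'n ^ 'n"
    by (simp add: vec_eq_iff matrix_scale_def)
  show ?thesis
    by (simp add: map_commutator_def left_mult_def jordan_prod_def commutator_def
        matrix_distribs quarter matrix_mul_assoc)
qed

lemma inner_derivation_is_skew_commutator:
  fixes D :: "'a::field ^ 'n ^ 'n \<Rightarrow> 'a ^ 'n ^ 'n"
  assumes "inner_derivation_on sym_matrices jordan_prod D"
  obtains s where "s \<in> skew_matrices" "\<And>x. x \<in> sym_matrices \<Longrightarrow> D x = commutator s x"
proof -
  obtain m :: nat and a b :: "nat \<Rightarrow> 'a ^ 'n ^ 'n" where
    ab: "\<And>k. k < m \<Longrightarrow> a k \<in> sym_matrices \<and> b k \<in> sym_matrices"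
    and D: "\<And>x. x \<in> sym_matrices \<Longrightarrow>
      D x = (\<Sum>k<m. map_commutator (left_mult jordan_prod (a k)) (left_mult jordan_prod (b k)) x)"
    using assms unfolding inner_derivation_on_def by blast
  define s where "s = (\<lambda>k. matrix_scale (1/4) (commutator (a k) (b k)))"
  have skew: "s k \<in> skew_matrices" if "k < m" for k
    using commutator_sym_sym_skew[of "a k" "b k"] ab[OF that]
    unfolding s_def by (blast intro: skew_matrices_scale)
  have "n \<le> m \<Longrightarrow> (\<Sum>k<n. s k) \<in> skew_matrices" for n
  proof (induction n)
    case 0
    show ?case by (simp add: skew_matrices_def)
  next
    case (Suc n)
    then show ?case by (simp add: skew skew_matrices_add)
  qed
  then have skew_sum: "(\<Sum>k<m. s k) \<in> skew_matrices" by blast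
  have sum: "(\<Sum>k<n. commutator (s k) x) = commutator (\<Sum>k<n. s k) x" for n :: nat and x
    by (induction n) (simp_all add: commutator_add_left, simp add: commutator_def)
  have "D x = commutator (\<Sum>k<m. s k) x" if "x \<in> sym_matrices" for x
    unfolding sum[symmetric] by (simp only: D[OF that] map_commutator_jordan_prod s_def)
  with skew_sum show thesis
    by (rule that)
qed

section \<open>Generators of the symmetric matrices\<close>

text \<open>
  The matrix \<open>c (e\<^bsub>ij\<^esub> + e\<^bsub>ji\<^esub>)\<close>. The diagonal case \<open>i = j\<close> gives \<open>2 c e\<^bsub>ii\<^esub>\<close>, so that one formula
  for commutators and one decomposition of symmetric matrices cover all cases.
\<close>

definition sym_unit :: "'n \<Rightarrow> 'n \<Rightarrow> 'a::field \<Rightarrow> 'a ^ 'n ^ 'n" where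
  "sym_unit i j c = (\<chi> k l. (if k = i \<and> l = j then c else 0) + (if k = j \<and> l = i then c else 0))"

lemma sym_unit_sym: "sym_unit i j c \<in> sym_matrices"
  unfolding sym_unit_def sym_matrices_def mem_Collect_eq vec_lambda_beta
  by (intro allI) (simp only: add.commute conj_commute)

lemma sym_unit_commute: "sym_unit i j c = sym_unit j i c"
  unfolding sym_unit_def vec_eq_iff vec_lambda_beta
  by (intro allI) (rule add.commute)

lemma commutator_sym_unit_nth:
  fixes s :: "'a::field ^ 'n ^ 'n"
  shows "commutator s (sym_unit i j c) $ k $ l =
     (if l = j then s $ k $ i * c else 0) + (if l = i then s $ k $ j * c else 0)
   - (if k = i then c * s $ j $ l else 0) - (if k = j then c * s $ i $ l else 0)"
proof -
  have left: "s $ k $ p * sym_unit i j c $ p $ l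
      = (if p = i then if l = j then s $ k $ i * c else 0 else 0)
      + (if p = j then if l = i then s $ k $ j * c else 0 else 0)" for p
    unfolding sym_unit_def by (cases "p = i"; cases "p = j") (simp_all add: distrib_left)
  have right: "sym_unit i j c $ k $ p * s $ p $ l
      = (if p = j then if k = i then c * s $ j $ l else 0 else 0)
      + (if p = i then if k = j then c * s $ i $ l else 0 else 0)" for p
    unfolding sym_unit_def by (cases "p = i"; cases "p = j") (simp_all add: distrib_right)
  show ?thesis
    unfolding commutator_def matrix_matrix_mult_def vector_minus_component vec_lambda_beta
      left right sum.distrib sum.delta[OF finite]
    by simp
qed

lemma sym_matrix_sum_sym_units:
  fixes x :: "'a::field ^ 'n ^ 'n"
  assumes two: "(2::'a) \<noteq> 0" and x: "x \<in> sym_matrices"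
  shows "x = (\<Sum>p\<in>UNIV. sym_unit (fst p) (snd p) (x $ fst p $ snd p / 2))"
proof -
  have "(\<Sum>p\<in>UNIV. sym_unit (fst p) (snd p) (x $ fst p $ snd p / 2)) $ k $ l = x $ k $ l" for k l
  proof -
    have "(\<Sum>p\<in>UNIV. sym_unit (fst p) (snd p) (x $ fst p $ snd p / 2)) $ k $ l
      = (\<Sum>p\<in>UNIV. (if p = (k, l) then x $ fst p $ snd p / 2 else 0)
                   + (if p = (l, k) then x $ fst p $ snd p / 2 else 0))"
      unfolding sum_component sym_unit_def vec_lambda_beta
      by (intro sum.cong refl)
        (simp only: prod_eq_iff fst_conv snd_conv eq_commute[of k] eq_commute[of l] conj_commute)
    also have "\<dots> = x $ k $ l / 2 + x $ l $ k / 2"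
      by (simp add: sum.distrib)
    also have "\<dots> = x $ k $ l"
    proof -
      have "x $ l $ k = x $ k $ l"
        using x unfolding sym_matrices_def by blast
      then show ?thesis
        using two by (simp flip: add_divide_distrib mult_2)
    qed
    finally show ?thesis .
  qed
  then show ?thesis by (simp add: vec_eq_iff)
qed

lemma additive_zero_on_sym_units:
  fixes g :: "'a::field ^ 'n ^ 'n \<Rightarrow> 'a ^ 'n ^ 'n"
  assumes two: "(2::'a) \<noteq> 0" and g: "additive_map_on sym_matrices g"
    and units: "\<And>i j c. g (sym_unit i j c) = 0" and x: "x \<in> sym_matrices"
  shows "g x = 0"
proof -
  have add: "g (u + v) = g u + g v" if "u \<in> sym_matrices" "v \<in> sym_matrices" for u v
    using g that by (simp add: additive_map_on_def)
  have zero: "(0::'a ^ 'n ^ 'n) \<in> sym_matrices"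
    by (simp add: sym_matrices_def)
  have g0: "g 0 = 0"
    using add[OF zero zero] by simp
  have *: "(\<Sum>p\<in>P. sym_unit (fst p) (snd p) (h p)) \<in> sym_matrices \<and>
      g (\<Sum>p\<in>P. sym_unit (fst p) (snd p) (h p)) = 0"
    if "finite P" for P :: "('n \<times> 'n) set" and h
    using that
    by (induction P rule: finite_induct) (simp_all add: zero g0 sym_matrices_add sym_unit_sym add units)
  show ?thesis
    by (subst sym_matrix_sum_sym_units[OF two x]) (rule conjunct2[OF *[OF finite]])
qed

section \<open>Additive maps that are locally commutators with skew matrices\<close>

definition locally_skew_commutator :: "('a::field ^ 'n ^ 'n \<Rightarrow> 'a ^ 'n ^ 'n) \<Rightarrow> bool" where
  "locally_skew_commutator f \<longleftrightarrow> additive_map_on sym_matrices f \<and>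
     (\<forall>x\<in>sym_matrices. \<exists>s\<in>skew_matrices. f x = commutator s x)"

lemma additive_local_inner_derivation_locally_skew:
  fixes f :: "'a::field ^ 'n ^ 'n \<Rightarrow> 'a ^ 'n ^ 'n"
  assumes "additive_local_inner_derivation_on sym_matrices jordan_prod f"
  shows "locally_skew_commutator f"
  using assms unfolding additive_local_inner_derivation_on_def locally_skew_commutator_def
  by (metis inner_derivation_is_skew_commutator)

lemma locally_skew_commutator_add:
  assumes "locally_skew_commutator f" "x \<in> sym_matrices" "y \<in> sym_matrices"
  shows "f (x + y) = f x + f y"
  using assms by (simp add: locally_skew_commutator_def additive_map_on_def)

lemma locally_skew_commutatorE:
  assumes "locally_skew_commutator f" "x \<in> sym_matrices"
  obtains s where "s \<in> skew_matrices" "f x = commutator s x"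
  using assms by (auto simp: locally_skew_commutator_def)

lemma skew_matrices_nth:
  "s \<in> skew_matrices \<Longrightarrow> s $ i $ j = - s $ j $ i"
  unfolding skew_matrices_def by blast

lemma skew_matrices_diag:
  fixes s :: "'a::field ^ 'n ^ 'n"
  assumes "(2::'a) \<noteq> 0" "s \<in> skew_matrices"
  shows "s $ i $ i = 0"
proof -
  have "2 * s $ i $ i = s $ i $ i + s $ i $ i" by simp
  also have "\<dots> = 0" using skew_matrices_nth[OF assms(2), of i i] by (simp add: eq_neg_iff_add_eq_0)
  finally show ?thesis using assms(1) by simp
qed

lemma locally_skew_commutator_diff:
  assumes f: "locally_skew_commutator f" and S: "S \<in> skew_matrices"
  shows "locally_skew_commutator (\<lambda>x. f x - commutator S x)"
  unfolding locally_skew_commutator_def additive_map_on_def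
proof (intro conjI ballI)
  fix x :: "'a ^ 'b ^ 'b" assume x: "x \<in> sym_matrices"
  obtain s where s: "s \<in> skew_matrices" "f x = commutator s x"
    using locally_skew_commutatorE[OF f x] .
  have sS: "s - S \<in> skew_matrices" "f x - commutator S x = commutator (s - S) x"
    using s S by (simp_all add: skew_matrices_diff commutator_diff_left)
  then show "\<exists>t\<in>skew_matrices. f x - commutator S x = commutator t x" by blast
  show "f x - commutator S x \<in> sym_matrices"
    using sS commutator_skew_sym[OF _ x] by metis
  fix y :: "'a ^ 'b ^ 'b" assume "y \<in> sym_matrices"
  then show "f (x + y) - commutator S (x + y) = f x - commutator S x + (f y - commutator S y)"
    using x by (simp add: locally_skew_commutator_add[OF f] commutator_add_right)
qed

text \<open>
  On \<open>F\<^bsub>ii\<^esub>(a) + F\<^bsub>ij\<^esub>(c)\<close> the commutator with \<open>s\<close> has entry \<open>2 c s\<^bsub>ij\<^esub>\<close> at \<open>(i, i)\<close> and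
  \<open>-2 a s\<^bsub>ij\<^esub>\<close> at \<open>(i, j)\<close>. By additivity the first is a function of \<open>c\<close> alone and the second a
  function of \<open>a\<close> alone, which makes \<open>s\<^bsub>ij\<^esub>\<close> independent of both.
\<close>

lemma local_values_on_block:
  fixes f :: "'a::field ^ 'n ^ 'n \<Rightarrow> 'a ^ 'n ^ 'n"
  assumes two: "(2::'a) \<noteq> 0" and f: "locally_skew_commutator f" and ij: "i \<noteq> j"
  defines "t \<equiv> f (sym_unit i j 1) $ i $ i / 2"
  shows "f (sym_unit i i a) $ i $ j = - 2 * a * t"
    and "f (sym_unit i j c) $ i $ i = 2 * c * t"
proof -
  have joint: "\<exists>r. f (sym_unit i i a) $ i $ j = - 2 * a * r \<and> f (sym_unit i j c) $ i $ i = 2 * c * r"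
    for a c
  proof -
    obtain s where s: "s \<in> skew_matrices"
      "f (sym_unit i i a + sym_unit i j c) = commutator s (sym_unit i i a + sym_unit i j c)"
      using locally_skew_commutatorE[OF f sym_matrices_add[OF sym_unit_sym sym_unit_sym]] .
    obtain s1 where s1: "s1 \<in> skew_matrices"
      "f (sym_unit i i a) = commutator s1 (sym_unit i i a)"
      using locally_skew_commutatorE[OF f sym_unit_sym] .
    obtain s2 where s2: "s2 \<in> skew_matrices"
      "f (sym_unit i j c) = commutator s2 (sym_unit i j c)"
      using locally_skew_commutatorE[OF f sym_unit_sym] .
    have sum: "f (sym_unit i i a) + f (sym_unit i j c)
        = commutator s (sym_unit i i a) + commutator s (sym_unit i j c)"
      using s(2) by (simp add: locally_skew_commutator_add[OF f] sym_unit_sym commutator_add_right)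
    have "f (sym_unit i i a) $ i $ i = 0"
      by (simp add: s1(2) commutator_sym_unit_nth skew_matrices_diag[OF two s1(1)])
    moreover have "f (sym_unit i j c) $ i $ j = 0"
      using ij by (simp add: s2(2) commutator_sym_unit_nth skew_matrices_diag[OF two s2(1)])
    moreover note arg_cong[OF sum, of "\<lambda>y. y $ i $ i"] arg_cong[OF sum, of "\<lambda>y. y $ i $ j"]
    ultimately show ?thesis
      using ij skew_matrices_nth[OF s(1), of j i]
      by (intro exI[of _ "s $ i $ j"])
        (simp add: commutator_sym_unit_nth skew_matrices_diag[OF two s(1)] algebra_simps)
  qed
  show diag: "f (sym_unit i i a) $ i $ j = - 2 * a * t" for a
    using joint[of a 1] two by (auto simp: t_def)
  show "f (sym_unit i j c) $ i $ i = 2 * c * t"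
    using joint[of 1 c] diag[of 1] two by auto
qed

lemma local_zero_on_diagonal_unit:
  fixes g :: "'a::field ^ 'n ^ 'n \<Rightarrow> 'a ^ 'n ^ 'n"
  assumes two: "(2::'a) \<noteq> 0" and g: "locally_skew_commutator g"
    and unit: "\<And>i j. i \<noteq> j \<Longrightarrow> g (sym_unit i j 1) $ i $ i = 0"
  shows "g (sym_unit i i a) = 0"
proof -
  obtain s where s: "s \<in> skew_matrices" "g (sym_unit i i a) = commutator s (sym_unit i i a)"
    using locally_skew_commutatorE[OF g sym_unit_sym] .
  have row: "g (sym_unit i i a) $ i $ l = 0" for l
  proof (cases "l = i")
    case True
    then show ?thesis by (simp add: s(2) commutator_sym_unit_nth skew_matrices_diag[OF two s(1)])
  next
    case False
    then show ?thesis using local_values_on_block(1)[OF two g, of i l a] unit[of i l] by simp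
  qed
  moreover have "g (sym_unit i i a) $ k $ l = g (sym_unit i i a) $ l $ k" for k l
    using commutator_skew_sym[OF s(1) sym_unit_sym] unfolding s(2) sym_matrices_def by blast
  moreover have "g (sym_unit i i a) $ k $ l = 0" if "k \<noteq> i" "l \<noteq> i" for k l
    using that by (simp add: s(2) commutator_sym_unit_nth)
  ultimately show ?thesis
    unfolding vec_eq_iff zero_index by metis
qed

text \<open>
  Adding the diagonal matrix \<open>\<epsilon> c (e\<^bsub>ii\<^esub> + e\<^bsub>jj\<^esub>)\<close> with \<open>\<epsilon> = \<plusminus>1\<close>, on which \<open>g\<close> vanishes, makes columns
  \<open>i\<close> and \<open>j\<close> of the argument equal up to the sign \<open>\<epsilon>\<close>. Outside the block, the corresponding columns
  of the value satisfy the same relation.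
\<close>

lemma local_columns_proportional:
  fixes g :: "'a::field ^ 'n ^ 'n \<Rightarrow> 'a ^ 'n ^ 'n"
  assumes two: "(2::'a) \<noteq> 0" and g: "locally_skew_commutator g"
    and diag: "\<And>i a. g (sym_unit i i a) = 0"
    and ne: "i \<noteq> j" "k \<noteq> i" "k \<noteq> j" and eps: "\<epsilon> * \<epsilon> = 1"
  shows "g (sym_unit i j c) $ k $ i = \<epsilon> * g (sym_unit i j c) $ k $ j"
proof -
  \<comment> \<open>The unit \<open>F\<^bsub>ii\<^esub>(a)\<close> is \<open>2 a e\<^bsub>ii\<^esub>\<close>, hence the division by \<open>2\<close>.\<close>
  define d where "d = \<epsilon> * c / 2"
  obtain s where s: "g (sym_unit i j c + (sym_unit i i d + sym_unit j j d))
      = commutator s (sym_unit i j c + (sym_unit i i d + sym_unit j j d))"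
    using locally_skew_commutatorE[OF g]
    by (metis sym_matrices_add sym_unit_sym)
  then have expand: "g (sym_unit i j c) = commutator s (sym_unit i j c)
      + (commutator s (sym_unit i i d) + commutator s (sym_unit j j d))"
    by (simp add: locally_skew_commutator_add[OF g] sym_unit_sym sym_matrices_add
        commutator_add_right diag)
  have dd: "x * d + x * d = \<epsilon> * (x * c)" for x
    using two by (simp add: d_def field_simps)
  have "\<epsilon> * (\<epsilon> * x) = x" for x
    using eps by (simp flip: mult.assoc)
  then show ?thesis
    using ne by (simp add: expand commutator_sym_unit_nth dd distrib_left)
qed

lemma local_zero_on_sym_unit:
  fixes g :: "'a::field ^ 'n ^ 'n \<Rightarrow> 'a ^ 'n ^ 'n"
  assumes two: "(2::'a) \<noteq> 0" and g: "locally_skew_commutator g"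
    and unit: "\<And>i j. i \<noteq> j \<Longrightarrow> g (sym_unit i j 1) $ i $ i = 0"
  shows "g (sym_unit i j c) = 0"
proof (cases "i = j")
  case True
  then show ?thesis using local_zero_on_diagonal_unit[OF two g unit] by simp
next
  case False
  let ?y = "g (sym_unit i j c)"
  obtain s where s: "s \<in> skew_matrices" "?y = commutator s (sym_unit i j c)"
    using locally_skew_commutatorE[OF g sym_unit_sym] .
  have sym: "?y $ k $ l = ?y $ l $ k" for k l
    using commutator_skew_sym[OF s(1) sym_unit_sym] unfolding s(2) sym_matrices_def by blast
  have outside: "?y $ k $ i = 0 \<and> ?y $ k $ j = 0" if k: "k \<noteq> i" "k \<noteq> j" for k
  proof -
    note proportional = local_columns_proportional[OF two g local_zero_on_diagonal_unit[OF two g unit] False k]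
    have "?y $ k $ i = ?y $ k $ j" "?y $ k $ i = - ?y $ k $ j"
      using proportional[of 1 c] proportional[of "-1" c] by simp_all
    then have "2 * ?y $ k $ j = 0" by (simp add: eq_neg_iff_add_eq_0)
    with \<open>?y $ k $ i = ?y $ k $ j\<close> two show ?thesis by simp
  qed
  have "?y $ i $ i = 0"
    using local_values_on_block(2)[OF two g False, of c] unit[OF False] by simp
  moreover have "?y $ j $ j = 0"
    using local_values_on_block(2)[OF two g False[symmetric], of c] unit[OF False[symmetric]]
    by (simp add: sym_unit_commute[of i j])
  moreover have "?y $ i $ j = 0"
    using False by (simp add: s(2) commutator_sym_unit_nth skew_matrices_diag[OF two s(1)])
  moreover have "?y $ k $ l = 0" if "k \<noteq> i" "k \<noteq> j" "l \<noteq> i" "l \<noteq> j" for k l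
    using that by (simp add: s(2) commutator_sym_unit_nth)
  ultimately show ?thesis
    unfolding vec_eq_iff zero_index using outside sym by metis
qed

lemma locally_skew_commutator_is_commutator:
  fixes f :: "'a::field ^ 'n ^ 'n \<Rightarrow> 'a ^ 'n ^ 'n"
  assumes two: "(2::'a) \<noteq> 0" and f: "locally_skew_commutator f"
  obtains S where "S \<in> skew_matrices" "\<And>x. x \<in> sym_matrices \<Longrightarrow> f x = commutator S x"
proof -
  define S :: "'a ^ 'n ^ 'n" where "S = (\<chi> i j. f (sym_unit i j 1) $ i $ i / 2)"
  have S_nth: "\<exists>s\<in>skew_matrices. S $ i $ j = s $ i $ j \<and> S $ j $ i = s $ j $ i" for i j
  proof -
    obtain s where s: "s \<in> skew_matrices" "f (sym_unit i j 1) = commutator s (sym_unit i j 1)"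
      using locally_skew_commutatorE[OF f sym_unit_sym] .
    have "S $ i $ j = s $ i $ j \<and> S $ j $ i = s $ j $ i"
      using two skew_matrices_nth[OF s(1), of j i]
      by (simp add: S_def sym_unit_commute[of j i] s(2) commutator_sym_unit_nth
          skew_matrices_diag[OF two s(1)])
    with s(1) show ?thesis by blast
  qed
  have S: "S \<in> skew_matrices"
    unfolding skew_matrices_def mem_Collect_eq using S_nth skew_matrices_nth by metis
  define g where "g = (\<lambda>x. f x - commutator S x)"
  have g: "locally_skew_commutator g"
    unfolding g_def by (rule locally_skew_commutator_diff[OF f S])
  have "g (sym_unit i j 1) $ i $ i = 0" if "i \<noteq> j" for i j
  proof -
    have "f (sym_unit i j 1) $ i $ i = 2 * S $ i $ j"
      using two by (simp add: S_def)
    then show ?thesis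
      using that skew_matrices_nth[OF S, of j i]
      by (simp add: g_def commutator_sym_unit_nth)
  qed
  then have "g (sym_unit i j c) = 0" for i j c
    by (rule local_zero_on_sym_unit[OF two g])
  then have "g x = 0" if "x \<in> sym_matrices" for x
    using additive_zero_on_sym_units[OF two _ _ that] g
    unfolding locally_skew_commutator_def by blast
  then show thesis
    using that[OF S] by (simp add: g_def)
qed

section \<open>Additive local inner derivations are derivations\<close>

theorem theorem3p8:
  fixes nabla :: "'a::field ^ 'n ^ 'n \<Rightarrow> 'a ^ 'n ^ 'n"
  assumes "(2::'a) \<noteq> 0"
    and "CARD('n) > 1"
    and "additive_local_inner_derivation_on sym_matrices jordan_prod nabla"
  shows "derivation_on sym_matrices matrix_scale jordan_prod nabla"
proof -
  obtain S where "S \<in> skew_matrices" and nabla: "\<And>x. x \<in> sym_matrices \<Longrightarrow> nabla x = commutator S x"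
    using locally_skew_commutator_is_commutator[OF assms(1)
        additive_local_inner_derivation_locally_skew[OF assms(3)]] by blast
  have scale: "matrix_scale c x \<in> sym_matrices" if "x \<in> sym_matrices" for c :: 'a and x :: "'a ^ 'n ^ 'n"
    using that by (simp add: sym_matrices_def matrix_scale_def)
  have "additive_map_on sym_matrices nabla"
    using assms(3) by (simp add: additive_local_inner_derivation_on_def)
  then show ?thesis
    by (simp add: derivation_on_def linear_map_on_def nabla scale jordan_prod_in_sym_matrices
        commutator_matrix_scale commutator_jordan_prod)
qed

end
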